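(* If $U:\mathbb R\to\mathbb R$ is a PSAHARA utility function and $h:\mathbb R\to\mathbb R$ is a (strictly) increasing continuous piecewise linear function, then $U\circ h$ is also a PSAHARA utility function.
   Context: For $\alpha\ge0$, $\beta>0$, $d\in\mathbb R$ and $x\in\mathbb R$, let $$\hat U(x;\alpha,\beta,d)=-\frac1{\alpha^2-1}\left((x-d)+\sqrt{\beta^2+(x-d)^2}\right)^{-\alpha}\left((x-d)+\alpha\sqrt{\beta^2+(x-d)^2}\right)\quad(\alpha\ne1),$$ $$\hat U(x;1,\beta,d)=\tfrac12\log\left((x-d)+\sqrt{\beta^2+(x-d)^2}\right)+\tfrac12\beta^{-2}(x-d)\left(\sqrt{\beta^2+(x-d)^2}-(x-d)\right).$$ A function $U:\mathbb R\to\mathbb R$ is a PSAHARA (piecewise SAHARA) utility function if there are $n\ge0$, a partition $-\infty=a_0<a_1<\dots<a_n<a_{n+1}=\infty$ and parameters $\alpha_k\ge0,\beta_k>0,d_k\in\mathbb R,\gamma_k>0,u_k\in\mathbb R$ ($k=0,\dots,n$) such that $U$ is increasing and continuous on $\mathbb R$ and $U(x)=\gamma_k\hat U(x;\alpha_k,\beta_k,d_k)+u_k$ for all $x\in(a_k,a_{k+1})$, $k=0,\dots,n$. Piecewise linear means affine on each of finitely many intervals partitioning $\mathbb R$. *)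

theory Defs
  imports "HOL-Analysis.Analysis"
begin

(* For \<beta> > 0 the quantity (x - d) + sqrt (\<beta>^2 + (x - d)^2) is positive,
   so powr and ln are applied within their usual domain. *)
definition sahara_hat :: "real \<Rightarrow> real \<Rightarrow> real \<Rightarrow> real \<Rightarrow> real" where
  "sahara_hat \<alpha> \<beta> d x =
     (if \<alpha> = 1
      then (1 / 2) * ln ((x - d) + sqrt (\<beta>\<^sup>2 + (x - d)\<^sup>2))
           + (1 / 2) * (1 / \<beta>\<^sup>2) * (x - d) * (sqrt (\<beta>\<^sup>2 + (x - d)\<^sup>2) - (x - d))
      else - (1 / (\<alpha>\<^sup>2 - 1))
           * ((x - d) + sqrt (\<beta>\<^sup>2 + (x - d)\<^sup>2)) powr (- \<alpha>)
           * ((x - d) + \<alpha> * sqrt (\<beta>\<^sup>2 + (x - d)\<^sup>2)))"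

(* The breakpoints are extended reals because the first one is - \<infinity> and the last one \<infinity>;
   strict monotonicity makes a 1, ..., a n real. Values of a beyond n + 1 and of the
   parameters beyond n are irrelevant. *)
definition psahara :: "(real \<Rightarrow> real) \<Rightarrow> bool" where
  "psahara U \<longleftrightarrow>
     strict_mono U \<and> continuous_on UNIV U \<and>
     (\<exists>(n::nat) (a::nat \<Rightarrow> ereal) (\<alpha>::nat \<Rightarrow> real) (\<beta>::nat \<Rightarrow> real) (d::nat \<Rightarrow> real)
        (\<gamma>::nat \<Rightarrow> real) (u::nat \<Rightarrow> real).
        a 0 = - \<infinity> \<and> a (n + 1) = \<infinity> \<and>
        (\<forall>k\<le>n. a k < a (k + 1)) \<and>
        (\<forall>k\<le>n. \<alpha> k \<ge> 0 \<and> \<beta> k > 0 \<and> \<gamma> k > 0) \<and>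
        (\<forall>k\<le>n. \<forall>x::real. a k < ereal x \<and> ereal x < a (k + 1) \<longrightarrow>
           U x = \<gamma> k * sahara_hat (\<alpha> k) (\<beta> k) (d k) x + u k))"

(* The intervals may be open, closed, half-open, unbounded or single points. *)
definition piecewise_linear :: "(real \<Rightarrow> real) \<Rightarrow> bool" where
  "piecewise_linear h \<longleftrightarrow>
     (\<exists>P::real set set. finite P \<and> partition_on UNIV P \<and>
        (\<forall>I\<in>P. is_interval I \<and> (\<exists>p q. \<forall>x\<in>I. h x = p * x + q)))"

end

theory Submission
  imports Defs
begin

text \<open>
  The hypotheses provide, for each of \<open>U\<close> and \<open>h\<close>, a finite set of exceptional reals such
  that the function has the required form on every connected set that avoids it: an affine form
  for \<open>h\<close> (\<open>piecewise_linear_breakpoints\<close>), a SAHARA form for \<open>U\<close> (\<open>psahara_breakpoints\<close>).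
  Conversely, a strictly increasing continuous function with such a finite set for the SAHARA form
  is a PSAHARA utility (\<open>psahara_if_breakpoints\<close>).

  Let \<open>B\<close> and \<open>C\<close> be such sets for \<open>U\<close> and \<open>h\<close>. Since \<open>h\<close> is injective, \<open>h -` B \<union> C\<close> is finite. If a
  connected set \<open>J\<close> avoids it, then \<open>h\<close> is affine on \<open>J\<close>, and its image \<open>h ` J\<close> is connected and
  avoids \<open>B\<close>, so \<open>U\<close> has SAHARA form there. The slope is positive unless \<open>J\<close> has at most
  one point, where there is nothing to show. It remains to see that the SAHARA form is stable under
  \<open>x \<mapsto> p x + q\<close> with \<open>p > 0\<close> (\<open>sahara_hat_affine_neq_one\<close>, \<open>sahara_hat_affine_one\<close>): the parameters
  \<open>\<beta>\<close> and \<open>d\<close> become \<open>\<beta> / p\<close> and \<open>(d - q) / p\<close>, \<open>\<alpha>\<close> is unchanged, and a factor \<open>p powr (1 - \<alpha>)\<close>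
  (for \<open>\<alpha> = 1\<close>, a constant \<open>ln p / 2\<close>) comes out, which \<open>\<gamma>\<close> and \<open>u\<close> absorb.
\<close>

section \<open>SAHARA form and affine substitutions\<close>

text \<open>
  The function \<open>f\<close> agrees on \<open>S\<close> with \<open>\<gamma> * sahara_hat \<alpha> \<beta> d + u\<close> for some admissible parameters.
  The set \<open>S\<close> is arbitrary; on a set with at most one point the condition always holds.
\<close>
definition sahara_on :: "real set \<Rightarrow> (real \<Rightarrow> real) \<Rightarrow> bool" where
  "sahara_on S f \<longleftrightarrow> (\<exists>\<alpha> \<beta> d \<gamma> u. \<alpha> \<ge> 0 \<and> \<beta> > 0 \<and> \<gamma> > 0 \<and>
     (\<forall>x\<in>S. f x = \<gamma> * sahara_hat \<alpha> \<beta> d x + u))"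

lemma sahara_on_subset_singleton:
  assumes "S \<subseteq> {c}"
  shows "sahara_on S f"
  unfolding sahara_on_def
proof (intro exI conjI ballI)
  fix x assume "x \<in> S"
  then show "f x = 1 * sahara_hat 0 1 0 x + (f c - sahara_hat 0 1 0 c)"
    using assms by auto
qed simp_all

lemma sqrt_scale:
  fixes p \<beta> d q x :: real
  assumes "p > 0"
  shows "sqrt (\<beta>\<^sup>2 + (p * x + q - d)\<^sup>2)
    = p * sqrt ((\<beta> / p)\<^sup>2 + (x - (d - q) / p)\<^sup>2)"
proof -
  have "\<beta>\<^sup>2 + (p * x + q - d)\<^sup>2 = p\<^sup>2 * ((\<beta> / p)\<^sup>2 + (x - (d - q) / p)\<^sup>2)"
    using assms by (simp add: field_simps power2_eq_square)
  then show ?thesis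
    using assms by (simp add: real_sqrt_mult)
qed

lemma add_sqrt_pos:
  fixes \<beta> y :: real
  assumes "\<beta> > 0"
  shows "y + sqrt (\<beta>\<^sup>2 + y\<^sup>2) > 0"
proof -
  have "\<bar>y\<bar> = sqrt (y\<^sup>2)" by simp
  also have "\<dots> < sqrt (\<beta>\<^sup>2 + y\<^sup>2)"
    using assms by (intro real_sqrt_less_mono) simp
  finally show ?thesis by linarith
qed

lemma sahara_hat_affine_neq_one:
  assumes "p > 0" "\<beta> > 0" "\<alpha> \<noteq> 1"
  shows "sahara_hat \<alpha> \<beta> d (p * x + q)
    = p powr (1 - \<alpha>) * sahara_hat \<alpha> (\<beta> / p) ((d - q) / p) x"
proof -
  define y where "y = x - (d - q) / p"
  define s where "s = sqrt ((\<beta> / p)\<^sup>2 + y\<^sup>2)"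
  have s: "sqrt (\<beta>\<^sup>2 + (p * x + q - d)\<^sup>2) = p * s"
    unfolding s_def y_def using assms(1) by (rule sqrt_scale)
  have y: "p * x + q - d = p * y"
    using assms by (simp add: y_def field_simps)
  have pos: "y + s > 0"
    unfolding s_def using assms by (intro add_sqrt_pos) simp
  have "(p * y + p * s) powr (- \<alpha>) * (p * y + \<alpha> * (p * s))
      = (p powr (- \<alpha>) * p) * ((y + s) powr (- \<alpha>) * (y + \<alpha> * s))"
    using assms pos by (simp add: distrib_left[symmetric] powr_mult) (simp add: algebra_simps)
  moreover have "p powr (- \<alpha>) * p = p powr (1 - \<alpha>)"
    using assms by (simp add: powr_diff powr_minus field_simps)
  ultimately have eq: "(p * y + p * s) powr (- \<alpha>) * (p * y + \<alpha> * (p * s))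
      = p powr (1 - \<alpha>) * ((y + s) powr (- \<alpha>) * (y + \<alpha> * s))"
    by simp
  have "sahara_hat \<alpha> \<beta> d (p * x + q)
      = - (1 / (\<alpha>\<^sup>2 - 1)) * ((p * y + p * s) powr (- \<alpha>) * (p * y + \<alpha> * (p * s)))"
    unfolding sahara_hat_def s unfolding y using assms by simp
  also have "\<dots> = p powr (1 - \<alpha>) *
      (- (1 / (\<alpha>\<^sup>2 - 1)) * ((y + s) powr (- \<alpha>) * (y + \<alpha> * s)))"
    unfolding eq by simp
  also have "- (1 / (\<alpha>\<^sup>2 - 1)) * ((y + s) powr (- \<alpha>) * (y + \<alpha> * s))
      = sahara_hat \<alpha> (\<beta> / p) ((d - q) / p) x"
    unfolding sahara_hat_def y_def[symmetric] s_def[symmetric] using assms by simp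
  finally show ?thesis .
qed

lemma sahara_hat_affine_one:
  assumes "p > 0" "\<beta> > 0"
  shows "sahara_hat 1 \<beta> d (p * x + q) = sahara_hat 1 (\<beta> / p) ((d - q) / p) x + ln p / 2"
proof -
  define y where "y = x - (d - q) / p"
  define s where "s = sqrt ((\<beta> / p)\<^sup>2 + y\<^sup>2)"
  have s: "sqrt (\<beta>\<^sup>2 + (p * x + q - d)\<^sup>2) = p * s"
    unfolding s_def y_def using assms(1) by (rule sqrt_scale)
  have y: "p * x + q - d = p * y"
    using assms by (simp add: y_def field_simps)
  have pos: "y + s > 0"
    unfolding s_def using assms by (intro add_sqrt_pos) simp
  have "ln (p * y + p * s) = ln p + ln (y + s)"
    using assms pos by (simp add: distrib_left[symmetric] ln_mult)
  moreover have "(1 / 2) * (1 / \<beta>\<^sup>2) * (p * y) * (p * s - p * y)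
      = (1 / 2) * (1 / (\<beta> / p)\<^sup>2) * y * (s - y)"
    using assms by (simp add: field_simps power2_eq_square)
  ultimately show ?thesis
    unfolding sahara_hat_def s unfolding y y_def[symmetric] s_def[symmetric]
    by (simp add: add_divide_distrib)
qed

lemma sahara_on_compose_affine:
  assumes "sahara_on (h ` J) U" "p > 0" "\<And>x. x \<in> J \<Longrightarrow> h x = p * x + q"
  shows "sahara_on J (U \<circ> h)"
proof -
  obtain \<alpha> \<beta> d \<gamma> u where par: "\<alpha> \<ge> 0" "\<beta> > 0" "\<gamma> > 0"
    and "\<forall>x\<in>h ` J. U x = \<gamma> * sahara_hat \<alpha> \<beta> d x + u"
    using assms(1) unfolding sahara_on_def by blast
  then have U: "(U \<circ> h) x = \<gamma> * sahara_hat \<alpha> \<beta> d (p * x + q) + u" if "x \<in> J" for x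
    using that assms(3) by auto
  show ?thesis
  proof (cases "\<alpha> = 1")
    case True
    show ?thesis unfolding sahara_on_def
    proof (intro exI conjI ballI)
      fix x assume "x \<in> J"
      then show "(U \<circ> h) x = \<gamma> * sahara_hat 1 (\<beta> / p) ((d - q) / p) x + (\<gamma> * (ln p / 2) + u)"
        using U True par assms(2) by (simp add: sahara_hat_affine_one distrib_left)
    qed (use par assms(2) in simp_all)
  next
    case False
    show ?thesis unfolding sahara_on_def
    proof (intro exI conjI ballI)
      fix x assume "x \<in> J"
      then show "(U \<circ> h) x
          = (\<gamma> * p powr (1 - \<alpha>)) * sahara_hat \<alpha> (\<beta> / p) ((d - q) / p) x + u"
        using U False par assms(2) by (simp add: sahara_hat_affine_neq_one)
    qed (use par assms(2) in simp_all)
  qed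
qed

section \<open>Partitions and finite sets of breakpoints\<close>

lemma finite_frontier_interval:
  fixes I :: "real set"
  assumes "is_interval I"
  shows "finite (frontier I)"
proof -
  obtain a b where cases: "I = {} \<or> I = UNIV \<or> I = {..<b} \<or> I = {..b} \<or> I = {a<..} \<or> I = {a..} \<or>
      I = {a<..<b} \<or> I = {a<..b} \<or> I = {a..<b} \<or> I = {a..b}"
    using is_real_interval[OF assms] by blast
  have "closure I - interior I \<subseteq> {a, b}"
    using cases by (cases "a < b") (auto simp: interior_open)
  then show ?thesis
    unfolding frontier_def by (rule finite_subset) simp
qed

lemma piecewise_linear_breakpoints:
  assumes "piecewise_linear h"
  obtains C where "finite C"
    and "\<And>J. connected J \<Longrightarrow> J \<inter> C = {} \<Longrightarrow> \<exists>p q. \<forall>x\<in>J. h x = p * x + q"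
proof -
  obtain P where P: "finite P" "partition_on UNIV P"
    and I: "\<And>I. I \<in> P \<Longrightarrow> is_interval I" "\<And>I. I \<in> P \<Longrightarrow> \<exists>p q. \<forall>x\<in>I. h x = p * x + q"
    using assms unfolding piecewise_linear_def by blast
  show thesis
  proof (rule that)
    show "finite (\<Union>I\<in>P. frontier I)"
      using P I finite_frontier_interval by blast
    fix J :: "real set" assume J: "connected J" "J \<inter> (\<Union>I\<in>P. frontier I) = {}"
    show "\<exists>p q. \<forall>x\<in>J. h x = p * x + q"
    proof (cases "J = {}")
      case False
      then obtain x where "x \<in> J" by blast
      moreover obtain I where "I \<in> P" "x \<in> I"
        using P(2) unfolding partition_on_def by blast
      \<comment> \<open>A connected set that meets \<open>I\<close> but not its frontier lies in \<open>I\<close>.\<close>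
      ultimately have "J \<subseteq> I"
        using J connected_Int_frontier[of J I] by blast
      then show ?thesis
        using I(2)[OF \<open>I \<in> P\<close>] by blast
    qed simp
  qed
qed

lemma psahara_breakpoints:
  assumes "psahara U"
  obtains B where "finite B"
    and "\<And>J. connected J \<Longrightarrow> J \<inter> B = {} \<Longrightarrow> sahara_on J U"
proof -
  obtain n and a :: "nat \<Rightarrow> ereal" and \<alpha> \<beta> d \<gamma> u :: "nat \<Rightarrow> real" where
    a: "a 0 = - \<infinity>" "a (n + 1) = \<infinity>"
    and par: "\<And>k. k \<le> n \<Longrightarrow> \<alpha> k \<ge> 0 \<and> \<beta> k > 0 \<and> \<gamma> k > 0"
    and U: "\<And>k x. k \<le> n \<Longrightarrow> a k < ereal x \<Longrightarrow> ereal x < a (k + 1) \<Longrightarrow>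
           U x = \<gamma> k * sahara_hat (\<alpha> k) (\<beta> k) (d k) x + u k"
    using assms unfolding psahara_def by blast
  \<comment> \<open>The infinite endpoints contribute the harmless extra point \<open>real_of_ereal (\<plusminus>\<infinity>) = 0\<close>.\<close>
  define B where "B = (real_of_ereal \<circ> a) ` {..n + 1}"
  show thesis
  proof (rule that)
    show "finite B" unfolding B_def by simp
    fix J assume J: "connected J" "J \<inter> B = {}"
    show "sahara_on J U"
    proof (cases "J = {}")
      case True
      then show ?thesis using sahara_on_subset_singleton by blast
    next
      case False
      then obtain x where x: "x \<in> J" by blast
      have avoid: "a k \<noteq> ereal y" if "k \<le> n + 1" "y \<in> J" for k y
      proof
        assume "a k = ereal y"
        then have "y = (real_of_ereal \<circ> a) k" by simp
        then have "y \<in> B" using that(1) unfolding B_def by blast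
        then show False using that(2) J(2) by blast
      qed
      \<comment> \<open>The index of the piece that contains \<open>x\<close>; all of \<open>J\<close> lies in that piece.\<close>
      define k where "k = Max {k. k \<le> n \<and> a k < ereal x}"
      have ne: "0 \<in> {k. k \<le> n \<and> a k < ereal x}" using a by simp
      have fin: "finite {k. k \<le> n \<and> a k < ereal x}" by simp
      have k: "k \<le> n" "a k < ereal x"
        using Max_in[OF fin] ne unfolding k_def by blast+
      have "\<not> a (k + 1) < ereal x"
      proof
        assume less: "a (k + 1) < ereal x"
        then have "k \<noteq> n" using a by auto
        with k less have "k + 1 \<in> {k. k \<le> n \<and> a k < ereal x}" by simp
        then have "k + 1 \<le> k" unfolding k_def using fin Max_ge by blast
        then show False by simp
      qed
      then have k': "ereal x < a (k + 1)"
        using avoid[of "k + 1" x] x k by force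
      have between: "z \<in> J" if "y \<in> J" "y' \<in> J" "y \<le> z" "z \<le> y'" for y y' z
        using J(1) that connectedD_interval by blast
      have sub: "a k < ereal y \<and> ereal y < a (k + 1)" if y: "y \<in> J" for y
      proof (rule ccontr)
        assume "\<not> ?thesis"
        then consider "ereal y \<le> a k" | "a (k + 1) \<le> ereal y"
          by fastforce
        then show False
        proof cases
          case 1
          with k(2) obtain z where "a k = ereal z" by (cases "a k") auto
          with 1 k avoid[of k z] between[OF y x, of z] show False by simp
        next
          case 2
          with k' obtain z where "a (k + 1) = ereal z" by (cases "a (k + 1)") auto
          with 2 k k' avoid[of "k + 1" z] between[OF x y, of z] show False by simp
        qed
      qed
      show ?thesis
        unfolding sahara_on_def using par[OF k(1)] U[OF k(1)] sub by blast
    qed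
  qed
qed

lemma psahara_if_breakpoints:
  assumes "strict_mono U" "continuous_on UNIV U" "finite B"
    and form: "\<And>J. connected J \<Longrightarrow> J \<inter> B = {} \<Longrightarrow> sahara_on J U"
  shows "psahara U"
proof -
  define xs where "xs = sorted_list_of_set B"
  define n where "n = length xs"
  define a where "a k = (if k = 0 then - \<infinity> else if k \<le> n then ereal (xs ! (k - 1)) else \<infinity>)" for k
  have set_xs: "set xs = B" and sorted: "sorted_wrt (<) xs"
    using assms(3) by (simp_all add: xs_def)
  have nth_less: "xs ! i < xs ! j" if "i < j" "j < n" for i j
    using sorted that by (simp add: sorted_wrt_iff_nth_less n_def)
  have a_less: "a i < a j" if "i < j" "j \<le> n + 1" for i j
    using that nth_less[of "i - 1" "j - 1"] by (auto simp: a_def)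
  have a_le: "a i \<le> a j" if "i \<le> j" "j \<le> n + 1" for i j
    using that a_less[of i j] by (cases "i = j") auto
  define J where "J k = {x. a k < ereal x \<and> ereal x < a (k + 1)}" for k
  have "sahara_on (J k) U" if "k \<le> n" for k
  proof (rule form)
    have "z \<in> J k" if "x \<in> J k" "y \<in> J k" "x \<le> z" "z \<le> y" for x y z
    proof -
      have "a k < ereal x" "ereal x \<le> ereal z" "ereal z \<le> ereal y" "ereal y < a (k + 1)"
        using that by (simp_all add: J_def)
      then have "a k < ereal z" "ereal z < a (k + 1)"
        using order.strict_trans2 order.strict_trans1 by blast+
      then show ?thesis by (simp add: J_def)
    qed
    then have "is_interval (J k)" unfolding is_interval_1 by blast
    then show "connected (J k)" by (simp add: is_interval_connected_1)
    have "b \<notin> J k" if mem: "b \<in> B" for b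
    proof -
      obtain i where i: "i < n" "xs ! i = b"
        using mem unfolding set_xs[symmetric] n_def in_set_conv_nth by blast
      then have b: "ereal b = a (i + 1)" by (simp add: a_def)
      consider "i + 1 \<le> k" | "k + 1 \<le> i + 1" by linarith
      then have "a (i + 1) \<le> a k \<or> a (k + 1) \<le> a (i + 1)"
        using a_le[of "i + 1" k] a_le[of "k + 1" "i + 1"] i(1) \<open>k \<le> n\<close> by auto
      then show ?thesis
        unfolding J_def mem_Collect_eq b by (auto simp: not_less)
    qed
    then show "J k \<inter> B = {}" by blast
  qed
  then have "\<forall>k. \<exists>\<alpha> \<beta> d \<gamma> u. k \<le> n \<longrightarrow> \<alpha> \<ge> 0 \<and> \<beta> > 0 \<and> \<gamma> > 0 \<and>
     (\<forall>x\<in>J k. U x = \<gamma> * sahara_hat \<alpha> \<beta> d x + u)"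
    unfolding sahara_on_def by blast
  then obtain \<alpha> \<beta> d \<gamma> u where par: "\<And>k. k \<le> n \<Longrightarrow> \<alpha> k \<ge> 0 \<and> \<beta> k > 0 \<and> \<gamma> k > 0 \<and>
     (\<forall>x\<in>J k. U x = \<gamma> k * sahara_hat (\<alpha> k) (\<beta> k) (d k) x + u k)"
    by metis
  show ?thesis
    unfolding psahara_def
  proof (intro conjI exI)
    show "a 0 = - \<infinity>" "a (n + 1) = \<infinity>" by (simp_all add: a_def)
    show "\<forall>k\<le>n. a k < a (k + 1)" using a_less by simp
    show "\<forall>k\<le>n. \<alpha> k \<ge> 0 \<and> \<beta> k > 0 \<and> \<gamma> k > 0" using par by blast
    show "\<forall>k\<le>n. \<forall>x. a k < ereal x \<and> ereal x < a (k + 1) \<longrightarrow>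
           U x = \<gamma> k * sahara_hat (\<alpha> k) (\<beta> k) (d k) x + u k"
      using par unfolding J_def by blast
  qed (use assms in blast)+
qed

section \<open>Composition with a piecewise linear function\<close>

theorem proposition1:
  fixes U h :: "real \<Rightarrow> real"
  assumes "psahara U"
    and "strict_mono h" and "continuous_on UNIV h" and "piecewise_linear h"
  shows "psahara (U \<circ> h)"
proof -
  have U: "strict_mono U" "continuous_on UNIV U"
    using assms(1) unfolding psahara_def by blast+
  obtain B where B: "finite B" "\<And>J. connected J \<Longrightarrow> J \<inter> B = {} \<Longrightarrow> sahara_on J U"
    using psahara_breakpoints[OF assms(1)] by blast
  obtain C where C: "finite C"
    "\<And>J. connected J \<Longrightarrow> J \<inter> C = {} \<Longrightarrow> \<exists>p q. \<forall>x\<in>J. h x = p * x + q"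
    using piecewise_linear_breakpoints[OF assms(4)] by blast
  show ?thesis
  proof (rule psahara_if_breakpoints)
    show "strict_mono (U \<circ> h)"
      using U(1) assms(2) by (simp add: strict_mono_def)
    show "continuous_on UNIV (U \<circ> h)"
      using U(2) assms(3) by (meson continuous_on_compose continuous_on_subset subset_UNIV)
    show "finite (h -` B \<union> C)"
      using B(1) C(1) assms(2) by (simp add: finite_vimageI strict_mono_imp_inj_on)
    fix J assume J: "connected J" "J \<inter> (h -` B \<union> C) = {}"
    have "connected (h ` J)"
      using J(1) assms(3) by (meson connected_continuous_image continuous_on_subset subset_UNIV)
    moreover have "h ` J \<inter> B = {}" using J(2) by blast
    ultimately have sahara: "sahara_on (h ` J) U" by (rule B(2))
    obtain p q where h: "\<And>x. x \<in> J \<Longrightarrow> h x = p * x + q"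
      using C(2)[of J] J by blast
    show "sahara_on J (U \<circ> h)"
    proof (cases "p > 0")
      case True
      then show ?thesis using sahara_on_compose_affine[OF sahara _ h] by blast
    next
      \<comment> \<open>On two points, strict monotonicity forces a positive slope.\<close>
      case False
      have "\<not> x < y" if "x \<in> J" "y \<in> J" for x y
      proof
        assume "x < y"
        then have "p * x < p * y"
          using strict_monoD[OF assms(2), of x y] h that by simp
        then show False
          using False \<open>x < y\<close> by (simp add: mult_less_cancel_left)
      qed
      then have "\<exists>c. J \<subseteq> {c}"
        by (metis linorder_neqE_linordered_idom singletonI subsetI)
      then show ?thesis using sahara_on_subset_singleton by blast
    qed
  qed
qed

end
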